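(* The set $\widehat W$ is the basin of attraction of the fixed point $x_0$ of the map $\hat f_\lambda(z)=\hat f(\lambda z)$.
   Context: Let $\ell\geq 2$ be an even integer. Let $f$ be the real analytic function which near $0$ coincides with the real fixed point of period-doubling renormalization with critical point of degree $\ell$. With $\lambda=-f(f(0))\in(0,1)$, it satisfies the Cvitanović–Feigenbaum equation: $f(z)=-\frac1\lambda f(f(\lambda z))$ near $0$; $f(0)=1$; and $f(z)=F(z^\ell)$, where $F^{-1}$ is defined and univalent on $\mathbb C_\lambda=\mathbb C\setminus(]-\infty,-1/\lambda]\cup[1/\lambda^2,+\infty[)$. An analytic extension of $f$ is a holomorphic function on a connected open subset of $\mathbb C$ which agrees with $f$ on some nonempty open set. It is known that $f$ has a unique maximal analytic extension $\hat f:\widehat W\to\mathbb C$, i.e. one of which all analytic extensions are restrictions, and that $\widehat W$ is a simply connected open subset of $\mathbb C$. The map $\hat f_\lambda$ is defined on $\widehat W/\lambda=\{z/\lambda: z\in\widehat W\}$. The point $x_0$ is the first positive preimage of $0$ by $f$ (the smallest positive real zero of $f$); it is an attracting fixed point of $\hat f_\lambda$, with multiplier $-\lambda$. Its basin of attraction is the set of points $z$ for which all iterates $\hat f_\lambda^n(z)$ are defined and converge to $x_0$. *)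

theory Defs
  imports "HOL-Complex_Analysis.Complex_Analysis"
begin

definition unimodal :: "(real \<Rightarrow> real) \<Rightarrow> bool" where
  "unimodal \<phi> \<longleftrightarrow>
     continuous_on {-1..1} \<phi> \<and> \<phi> ` {-1..1} \<subseteq> {-1..1} \<and> \<phi> 0 = 1 \<and>
     strict_mono_on {-1..0} \<phi> \<and> strict_antimono_on {0..1} \<phi>"

definition critical_degree :: "(real \<Rightarrow> real) \<Rightarrow> nat \<Rightarrow> bool" where
  "critical_degree \<phi> l \<longleftrightarrow>
     (\<forall>k. 0 < k \<and> k < l \<longrightarrow> (deriv ^^ k) \<phi> 0 = 0) \<and> (deriv ^^ l) \<phi> 0 \<noteq> 0"

definition pd_scale :: "(real \<Rightarrow> real) \<Rightarrow> real" where
  "pd_scale \<phi> = - \<phi> (\<phi> 0)"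

text \<open>The central interval is exchanged by \<open>\<phi>\<close> with an interval disjoint from it.\<close>

definition pd_renormalizable :: "(real \<Rightarrow> real) \<Rightarrow> bool" where
  "pd_renormalizable \<phi> \<longleftrightarrow>
     (let J = {- pd_scale \<phi>..pd_scale \<phi>} in
        0 < pd_scale \<phi> \<and> pd_scale \<phi> < 1 \<and> \<phi> ` J \<inter> J = {} \<and> \<phi> ` \<phi> ` J \<subseteq> J)"

definition pd_renorm :: "(real \<Rightarrow> real) \<Rightarrow> real \<Rightarrow> real" where
  "pd_renorm \<phi> x = - (1 / pd_scale \<phi>) * \<phi> (\<phi> (pd_scale \<phi> * x))"

definition pd_fixed_point :: "nat \<Rightarrow> (real \<Rightarrow> real) \<Rightarrow> bool" where
  "pd_fixed_point l \<phi> \<longleftrightarrow>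
     unimodal \<phi> \<and> critical_degree \<phi> l \<and> pd_renormalizable \<phi> \<and>
     (\<forall>x\<in>{-1..1}. pd_renorm \<phi> x = \<phi> x)"

definition slit_plane :: "real \<Rightarrow> complex set" where
  "slit_plane lam = - (complex_of_real ` ({..- 1 / lam} \<union> {1 / lam\<^sup>2..}))"

text \<open>
  HOL functions being total, an analytic function is given together with its domain \<open>D\<close>.
  Real analyticity of \<open>\<phi>\<close> on \<open>[-1, 1]\<close> is expressed by its being the restriction of a function
  \<open>f\<close> holomorphic on a neighbourhood \<open>D\<close> of that interval.  In the last conjunct \<open>G\<close> is the
  univalent map \<open>F\<^sup>-\<^sup>1\<close>.
\<close>

definition feigenbaum_map ::
    "nat \<Rightarrow> real \<Rightarrow> (complex \<Rightarrow> complex) \<Rightarrow> complex set \<Rightarrow> bool" where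
  "feigenbaum_map l lam f D \<longleftrightarrow>
     open D \<and> connected D \<and> complex_of_real ` {-1..1} \<subseteq> D \<and> f holomorphic_on D \<and>
     (\<exists>\<phi>. pd_fixed_point l \<phi> \<and>
          (\<forall>x\<in>{-1..1}. f (complex_of_real x) = complex_of_real (\<phi> x))) \<and>
     complex_of_real lam = - f (f 0) \<and> 0 < lam \<and> lam < 1 \<and>
     (\<forall>\<^sub>F z in nhds 0. f z = - (1 / of_real lam) * f (f (of_real lam * z))) \<and>
     f 0 = 1 \<and>
     (\<exists>F G. G holomorphic_on slit_plane lam \<and> inj_on G (slit_plane lam) \<and>
            (\<forall>w\<in>slit_plane lam. F (G w) = w) \<and>
            (\<forall>\<^sub>F z in nhds 0. z ^ l \<in> G ` slit_plane lam \<and> f z = F (z ^ l)))"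

definition first_positive_zero :: "(complex \<Rightarrow> complex) \<Rightarrow> complex set \<Rightarrow> real \<Rightarrow> bool" where
  "first_positive_zero f D x0 \<longleftrightarrow>
     0 < x0 \<and> complex_of_real x0 \<in> D \<and> f (complex_of_real x0) = 0 \<and>
     (\<forall>x. 0 < x \<and> x < x0 \<and> complex_of_real x \<in> D \<longrightarrow> f (complex_of_real x) \<noteq> 0)"

definition analytic_extension ::
    "(complex \<Rightarrow> complex) \<Rightarrow> complex set \<Rightarrow> (complex \<Rightarrow> complex) \<Rightarrow> complex set \<Rightarrow> bool" where
  "analytic_extension f D g V \<longleftrightarrow>
     open V \<and> connected V \<and> g holomorphic_on V \<and>
     (\<exists>S. open S \<and> S \<noteq> {} \<and> S \<subseteq> D \<inter> V \<and> (\<forall>z\<in>S. g z = f z))"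

definition maximal_analytic_extension ::
    "(complex \<Rightarrow> complex) \<Rightarrow> complex set \<Rightarrow> (complex \<Rightarrow> complex) \<Rightarrow> complex set \<Rightarrow> bool" where
  "maximal_analytic_extension f D g V \<longleftrightarrow>
     analytic_extension f D g V \<and>
     (\<forall>h U. analytic_extension f D h U \<longrightarrow> U \<subseteq> V \<and> (\<forall>z\<in>U. h z = g z))"

text \<open>Basin of \<open>p\<close> for a map \<open>g\<close> regarded as defined only on \<open>V\<close>.\<close>

definition basin_of_attraction ::
    "(complex \<Rightarrow> complex) \<Rightarrow> complex set \<Rightarrow> complex \<Rightarrow> complex set" where
  "basin_of_attraction g V p =
     {z. (\<forall>n. (g ^^ n) z \<in> V) \<and> (\<lambda>n. (g ^^ n) z) \<longlonglongrightarrow> p}"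

end

(* The equation f (f (lam z)) = - lam f z says that f linearizes g z = f (lam z) at x0, and the point is
   that f is proper over arbitrarily large slit planes.  Let P_n = (-1/lam)^n C_lam.  On
   W_0 = {z. z^l : G(C_lam)} the map f is the composition of z^l with the inverse of G, hence
   proper onto P_0; the functional equation propagates this to f : W_n -> P_n, where
   W_(n+1) = {z. lam z : W_n and f (lam z) : W_n}, because W_n lies in P_n.  Each W_n is connected
   because its fibre over a connected set containing the real segment [-lam^-n, lam^-n] is: for
   n = 0 every component of the fibre is mapped onto the base and so contains the only preimage 0
   of the critical value 1, and the functional equation writes the fibres for n + 1 as
   fibres of fibres for n.  Maximality then gives W_n <= What, and properness shows that a path
   from 0 inside What, whose image under f lies in P_n for large n, stays in W_n.  Hence every
   point of What lies in all W_n with n large, so that z : What iff lam z : What and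
   f (lam z) : What; convergence of orbits follows from f (g^n z) = (-lam)^n f z -> 0. *)

theory Submission
  imports Defs
begin

section \<open>Properness of the power map and connectedness of its preimages\<close>

lemma power_tendsto_subseq:
  fixes z :: "nat \<Rightarrow> complex"
  assumes "l > 0" and lim: "(\<lambda>j. z j ^ l) \<longlonglongrightarrow> a"
  obtains c r where "strict_mono r" "(z \<circ> r) \<longlonglongrightarrow> c" "c ^ l = a"
proof -
  from lim have "Bseq (\<lambda>j. z j ^ l)"
    using convergentI convergent_imp_Bseq by blast
  then obtain B where B: "B > 0" "\<And>j. norm (z j ^ l) \<le> B"
    by (auto simp: Bseq_def)
  have "norm (z j) \<le> max 1 B" for j
  proof (rule ccontr)
    assume "\<not> ?thesis"
    then have "1 < norm (z j)" "B < norm (z j)" by auto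
    moreover from this have "norm (z j) \<le> norm (z j) ^ l"
      using \<open>l > 0\<close> by (simp add: self_le_power)
    ultimately show False using B(2)[of j] by (simp add: norm_power)
  qed
  then have "bounded (range z)" by (auto simp: bounded_iff)
  then obtain c r where r: "strict_mono r" "(z \<circ> r) \<longlonglongrightarrow> c"
    using bounded_imp_convergent_subsequence by metis
  then have "(\<lambda>j. (z \<circ> r) j ^ l) \<longlonglongrightarrow> c ^ l" by (intro tendsto_intros)
  moreover have "(\<lambda>j. (z \<circ> r) j ^ l) \<longlonglongrightarrow> a"
    using LIMSEQ_subseq_LIMSEQ[OF lim r(1)] by (simp add: o_def)
  ultimately have "c ^ l = a" by (rule LIMSEQ_unique)
  with r that show ?thesis by blast
qed

text \<open>The image of a component of the preimage is open by the open mapping theorem and closed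
  in \<open>S\<close> by properness, hence equal to \<open>S\<close>. So every component contains a
  root of 0, and the only such root is 0.\<close>

lemma connected_power_vimage:
  fixes S :: "complex set"
  assumes "l > 0" "open S" "connected S" "0 \<in> S"
  shows "connected {z. z ^ l \<in> S}"
proof -
  define R where "R = {z. z ^ l \<in> S}"
  have "open R"
  proof -
    have "open ((\<lambda>z. z ^ l) -` S)"
      using \<open>open S\<close> by (rule open_vimage) (intro continuous_intros)
    then show ?thesis by (simp add: R_def vimage_def)
  qed
  have "0 \<in> R" using assms by (simp add: R_def zero_power)
  have comp: "connected_component R z 0" if "z \<in> R" for z
  proof -
    define C where "C = connected_component_set R z"
    have "z \<in> C" "C \<subseteq> R" using that by (auto simp: C_def connected_component_subset)
    have "open C" unfolding C_def using \<open>open R\<close> by (rule open_connected_component)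
    have "open ((\<lambda>z. z ^ l) ` C)"
    proof (rule open_mapping_thm[of _ UNIV])
      show "\<not> (\<lambda>z::complex. z ^ l) constant_on UNIV"
        using \<open>l > 0\<close> by (metis UNIV_I constant_on_def power_one zero_neq_one zero_power)
    qed (use \<open>open C\<close> in \<open>auto intro!: holomorphic_intros\<close>)
    then have "openin (top_of_set S) ((\<lambda>z. z ^ l) ` C)"
      using \<open>C \<subseteq> R\<close> by (auto simp: R_def openin_open)
    moreover have "closedin (top_of_set S) ((\<lambda>z. z ^ l) ` C)"
      unfolding closedin_limpt
    proof (intro conjI allI impI)
      show "(\<lambda>z. z ^ l) ` C \<subseteq> S" using \<open>C \<subseteq> R\<close> by (auto simp: R_def)
    next
      fix a assume a: "a islimpt (\<lambda>z. z ^ l) ` C \<and> a \<in> S"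
      then obtain y where y: "\<And>j::nat. y j \<in> (\<lambda>z. z ^ l) ` C" "y \<longlonglongrightarrow> a"
        by (meson DiffE islimpt_sequential)
      then obtain u where u: "\<And>j. u j \<in> C" "\<And>j. y j = u j ^ l"
        unfolding image_iff by metis
      have "(\<lambda>j. u j ^ l) \<longlonglongrightarrow> a"
        using y(2) u(2) by (simp add: LIMSEQ_def)
      then obtain c r where c: "strict_mono r" "(u \<circ> r) \<longlonglongrightarrow> c" "c ^ l = a"
        using power_tendsto_subseq[OF \<open>l > 0\<close>] by blast
      then have "c \<in> R" using a by (simp add: R_def)
      have "closedin (top_of_set R) C" unfolding C_def by (rule closedin_connected_component)
      then obtain A where A: "closed A" "C = R \<inter> A" by (auto simp: closedin_closed)
      then have "c \<in> A" using u(1) by (intro closed_sequentially[OF _ _ c(2)]) auto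
      with \<open>c \<in> R\<close> A have "c \<in> C" by blast
      then show "a \<in> (\<lambda>z. z ^ l) ` C" using c(3) by blast
    qed
    ultimately have "(\<lambda>z. z ^ l) ` C = S"
      using \<open>connected S\<close> \<open>z \<in> C\<close> unfolding connected_clopen by blast
    then obtain w where "w \<in> C" "w ^ l = 0" using \<open>0 \<in> S\<close> by force
    then show ?thesis using \<open>l > 0\<close> by (simp add: C_def)
  qed
  have "connected_component R x y" if "x \<in> R" "y \<in> R" for x y
    using comp[OF that(1)] comp[OF that(2)] connected_component_sym connected_component_trans by metis
  then show ?thesis unfolding R_def[symmetric] connected_iff_connected_component by blast
qed

section \<open>Topology of the slit plane\<close>

lemma slit_plane_iff:
  "z \<in> slit_plane lam \<longleftrightarrow> \<not> (Im z = 0 \<and> (Re z \<le> - 1 / lam \<or> 1 / lam\<^sup>2 \<le> Re z))"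
  by (auto simp: slit_plane_def image_iff complex_eq_iff)

lemma of_real_in_slit_plane:
  "complex_of_real x \<in> slit_plane lam \<longleftrightarrow> - 1 / lam < x \<and> x < 1 / lam\<^sup>2"
  by (auto simp: slit_plane_iff)

lemma open_slit_plane: "open (slit_plane lam)"
proof -
  have "closed {z. Im z = 0 \<and> (Re z \<le> - 1 / lam \<or> 1 / lam\<^sup>2 \<le> Re z)}"
    by (intro closed_Collect_conj closed_Collect_disj closed_Collect_eq closed_Collect_le continuous_intros)
  moreover have "slit_plane lam = - {z. Im z = 0 \<and> (Re z \<le> - 1 / lam \<or> 1 / lam\<^sup>2 \<le> Re z)}"
    by (auto simp: slit_plane_iff)
  ultimately show ?thesis by auto
qed

lemma slit_plane_scale:
  assumes "lam > 0" "z \<in> slit_plane lam" "0 \<le> t" "t \<le> 1"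
  shows "of_real t * z \<in> slit_plane lam"
proof (rule ccontr)
  assume "\<not> ?thesis"
  then have *: "t * Im z = 0" "t * Re z \<le> - 1 / lam \<or> 1 / lam\<^sup>2 \<le> t * Re z"
    by (auto simp: slit_plane_iff)
  have pos: "0 < 1 / lam" "0 < 1 / lam\<^sup>2" using assms by auto
  then have "t \<noteq> 0" using *(2) by auto
  then have t: "t > 0" "Im z = 0" using assms * by auto
  \<comment> \<open>Scaling keeps the sign of \<open>Re z\<close> and does not increase its modulus,
    so if \<open>t * z\<close> lies on a slit, then so does \<open>z\<close>.\<close>
  have "t * Re z \<ge> Re z \<or> Re z > 0" "t * Re z \<le> Re z \<or> Re z < 0"
    using assms by (auto simp: mult_le_cancel_right1 mult_le_cancel_right2 not_less)
  moreover have "Re z > 0 \<longrightarrow> t * Re z > 0" "Re z < 0 \<longrightarrow> t * Re z < 0"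
    using t by (auto simp: mult_pos_neg)
  ultimately have "Re z \<le> - 1 / lam \<or> 1 / lam\<^sup>2 \<le> Re z" using *(2) pos by linarith
  with t assms(2) show False by (simp add: slit_plane_iff)
qed

lemma connected_slit_plane:
  assumes "lam > 0" shows "connected (slit_plane lam)"
proof -
  have "starlike (slit_plane lam)"
    unfolding starlike_def
  proof (intro bexI ballI subsetI)
    show "0 \<in> slit_plane lam" using assms by (simp add: slit_plane_iff)
    fix x y assume "x \<in> slit_plane lam" "y \<in> closed_segment 0 x"
    then show "y \<in> slit_plane lam"
      using slit_plane_scale[OF assms] by (auto simp: in_segment scaleR_conv_of_real)
  qed
  then show ?thesis by (rule starlike_imp_connected)
qed

lemma holomorphic_on_imp_isCont:
  "f holomorphic_on S \<Longrightarrow> open S \<Longrightarrow> z \<in> S \<Longrightarrow> isCont f z"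
  using continuous_on_eq_continuous_at holomorphic_on_imp_continuous_on by blast

text \<open>Here \<open>f\<close> stands for the maximal extension and \<open>G\<close> for the
  inverse of \<open>F\<close>. The assumption \<open>ext\<close> is maximality for functions given
  by their germ at 0, the form in which the extensions below arise.\<close>

locale feigenbaum_extension =
  fixes l :: nat and lam x0 :: real and \<phi> :: "real \<Rightarrow> real"
    and F G f :: "complex \<Rightarrow> complex" and What :: "complex set"
  assumes l: "even l" "l > 0" and lam: "0 < lam" "lam < 1"
    and phi_range: "\<And>x. -1 \<le> x \<Longrightarrow> x \<le> 1 \<Longrightarrow> -1 \<le> \<phi> x \<and> \<phi> x \<le> 1"
    and phi_cont: "continuous_on {-1..1} \<phi>"
    and phi_antimono: "strict_antimono_on {0..1} \<phi>"
    and phi_0: "\<phi> 0 = 1" and phi_1: "\<phi> 1 = - lam"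
    and phi_lam_x0: "\<phi> (lam * x0) = x0"
    and x0: "0 < x0" "x0 < 1" "\<phi> x0 = 0"
    and openW: "open What" and holf: "f holomorphic_on What"
    and unit_What: "complex_of_real ` {-1..1} \<subseteq> What"
    and f_phi: "\<And>x. -1 \<le> x \<Longrightarrow> x \<le> 1 \<Longrightarrow> f (of_real x) = of_real (\<phi> x)"
    and f_eq_near_0: "\<forall>\<^sub>F z in nhds 0. f z = - (1 / of_real lam) * f (f (of_real lam * z))"
    and holG: "G holomorphic_on slit_plane lam" and injG: "inj_on G (slit_plane lam)"
    and FG: "\<And>w. w \<in> slit_plane lam \<Longrightarrow> F (G w) = w"
    and f_F_near_0: "\<forall>\<^sub>F z in nhds 0. z ^ l \<in> G ` slit_plane lam \<and> f z = F (z ^ l)"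
    and ext: "\<And>h U. \<lbrakk>open U; connected U; 0 \<in> U; h holomorphic_on U; \<forall>\<^sub>F z in nhds 0. h z = f z\<rbrakk>
               \<Longrightarrow> U \<subseteq> What \<and> (\<forall>z\<in>U. h z = f z)"
    and connW: "connected What"
begin

section \<open>Values of \<open>G\<close> on the real line\<close>

abbreviation "slit \<equiv> slit_plane lam"

lemma slit_real: "complex_of_real ` {-1..1} \<subseteq> slit"
proof -
  have "1 < 1 / lam" "1 < 1 / lam\<^sup>2" using lam by (auto simp: power_less_one_iff)
  then show ?thesis by (auto simp: of_real_in_slit_plane)
qed

text \<open>The identity holds near 0 because \<open>F\<close> inverts \<open>G\<close>, and
  analytic continuation carries it along \<open>C\<close>. The continuation \<open>k\<close> is
  arbitrary so that both \<open>f\<close> and its renormalization formula can be used.\<close>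

lemma G_eq_power:
  assumes U: "open U" "k holomorphic_on U" "\<forall>\<^sub>F z in nhds 0. k z = f z"
    and C: "connected C" "0 \<in> C" "C \<subseteq> U" "k ` C \<subseteq> slit" "z \<in> C"
  shows "G (k z) = z ^ l"
proof -
  define V where "V = U \<inter> k -` slit"
  have "open V" unfolding V_def using U open_slit_plane
    by (intro continuous_open_preimage holomorphic_on_imp_continuous_on)
  have "C \<subseteq> V" using C by (auto simp: V_def)
  define T where "T = connected_component_set V 0"
  have T: "open T" "connected T" "C \<subseteq> T" "T \<subseteq> V"
    using \<open>open V\<close> C \<open>C \<subseteq> V\<close>
    by (auto simp: T_def open_connected_component connected_component_subset connected_component_maximal
      intro: connected_component_maximal[THEN subsetD])
  have "\<forall>\<^sub>F z in nhds 0. k z = f z \<and> z ^ l \<in> G ` slit \<and> f z = F (z ^ l) \<and> z \<in> T"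
    using U(3) f_F_near_0 eventually_nhds_in_open[OF T(1) subsetD[OF T(3) C(2)]]
    by eventually_elim auto
  then obtain S where S: "open S" "0 \<in> S"
      "\<And>z. z \<in> S \<Longrightarrow> k z = f z \<and> z ^ l \<in> G ` slit \<and> f z = F (z ^ l) \<and> z \<in> T"
    unfolding eventually_nhds by auto
  show ?thesis
  proof (rule analytic_continuation_open[of S T "\<lambda>z. G (k z)" "\<lambda>z. z ^ l" z])
    show "(\<lambda>z. G (k z)) holomorphic_on T"
      using T holomorphic_on_compose_gen[OF holomorphic_on_subset[OF U(2)] holG, of T]
      by (auto simp: V_def o_def)
    show "G (k z) = z ^ l" if "z \<in> S" for z
      using S(3)[OF that] FG by auto
    show "S \<subseteq> T" using S(3) by blast
    show "z \<in> T" using T(3) C(5) by blast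
    show "(\<lambda>z. z ^ l) holomorphic_on T" by (intro holomorphic_intros)
  qed (use S(1,2) T(1,2) in auto)
qed

lemma G_phi:
  assumes "-1 \<le> x" "x \<le> 1"
  shows "G (of_real (\<phi> x)) = of_real (x ^ l)"
proof -
  have conn: "connected (complex_of_real ` {-1..1})"
    by (intro connected_continuous_image continuous_intros) auto
  have "0 \<in> complex_of_real ` {-1..1}" by (rule image_eqI[of _ _ 0]) auto
  moreover have "f ` complex_of_real ` {-1..1} \<subseteq> slit"
  proof -
    have "f ` complex_of_real ` {-1..1} \<subseteq> complex_of_real ` {-1..1}"
      using f_phi phi_range by fastforce
    with slit_real show ?thesis by blast
  qed
  ultimately have "G (f (of_real x)) = of_real x ^ l"
    using assms by (intro G_eq_power[OF openW holf _ conn _ unit_What]) auto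
  then show ?thesis using assms f_phi by simp
qed

lemma phi_onto:
  assumes "- lam \<le> u" "u \<le> 1"
  obtains x where "0 \<le> x" "x \<le> 1" "\<phi> x = u"
  using IVT2'[of \<phi> 1 u 0] assms phi_0 phi_1 continuous_on_subset[OF phi_cont, of "{0..1}"] by auto

text \<open>Schwarz reflection: \<open>\<phi>\<close> covers \<open>[- lam, 1]\<close>, where
  \<open>G\<close> therefore takes real values \<open>x ^ l\<close>. There it agrees with its
  reflection, hence everywhere by the identity theorem.\<close>

lemma G_cnj:
  assumes "w \<in> slit"
  shows "G (cnj w) = cnj (G w)"
proof -
  have cnj_slit: "cnj ` slit = slit"
    by (force simp: image_iff slit_plane_iff intro!: bexI[of _ "cnj _"])
  have hol: "(\<lambda>w. (cnj \<circ> G \<circ> cnj) w - G w) holomorphic_on slit"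
    using cnj_slit holG open_slit_plane
    by (intro holomorphic_on_diff holomorphic_on_compose_cnj_cnj) auto
  have lim: "(0::complex) islimpt complex_of_real ` {-lam..1}"
    unfolding islimpt_approachable
  proof (intro allI impI)
    fix e :: real assume "e > 0"
    then show "\<exists>x'\<in>complex_of_real ` {-lam..1}. x' \<noteq> 0 \<and> dist x' 0 < e"
      using lam by (intro bexI[of _ "of_real (min (e/2) 1)"]) auto
  qed
  have sub: "complex_of_real ` {-lam..1} \<subseteq> slit"
    using slit_real lam by (intro order.trans[OF image_mono slit_real]) auto
  have "0 \<in> slit"
    using lam by (simp add: slit_plane_iff)
  have "(cnj \<circ> G \<circ> cnj) u - G u = 0" if u: "u \<in> complex_of_real ` {-lam..1}" for u
  proof -
    from u obtain v where v: "u = of_real v" "-lam \<le> v" "v \<le> 1"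
      by (metis atLeastAtMost_iff image_iff)
    obtain x where x: "0 \<le> x" "x \<le> 1" "\<phi> x = v" using phi_onto v by blast
    then have "G u = of_real (x ^ l)" using G_phi[of x] v by simp
    then show ?thesis by (simp add: v)
  qed
  then have "(cnj \<circ> G \<circ> cnj) w - G w = 0"
    by (rule analytic_continuation[OF hol open_slit_plane connected_slit_plane[OF lam(1)] sub
          \<open>0 \<in> slit\<close> lim _ assms])
  then have "cnj (cnj (G (cnj w))) = cnj (G w)" by simp
  then show ?thesis by simp
qed

lemma real_if_G_real:
  assumes "w \<in> slit" "G w \<in> \<real>"
  shows "Im w = 0"
proof -
  have "cnj w \<in> slit" using assms by (simp add: slit_plane_iff)
  moreover have "G (cnj w) = G w" using assms by (simp add: G_cnj Reals_cnj_iff)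
  ultimately have "cnj w = w" using assms injG by (auto dest: inj_onD)
  then show ?thesis by (simp add: complex_eq_iff)
qed

text \<open>For \<open>x = lam * y\<close> these bounds keep both evaluations in the renormalization
  formula inside \<open>[-1, 1]\<close> and its value in \<open>]- 1 / lam, 1]\<close>.\<close>

lemma phi_interior:
  assumes "0 \<le> x" "x < x0"
  shows "0 < \<phi> x" "\<phi> x \<le> 1" "- lam \<le> \<phi> (\<phi> x)" "\<phi> (\<phi> x) < 1"
proof -
  note a = monotone_onD[OF phi_antimono]
  show "0 < \<phi> x" using a[of x x0] assms x0 by auto
  show "\<phi> x \<le> 1" using a[of 0 x] assms x0 phi_0 by (cases "x = 0") auto
  show "- lam \<le> \<phi> (\<phi> x)" using a[of "\<phi> x" 1] phi_1 \<open>0 < \<phi> x\<close> \<open>\<phi> x \<le> 1\<close>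
    by (cases "\<phi> x = 1") auto
  show "\<phi> (\<phi> x) < 1" using a[of 0 "\<phi> x"] phi_0 \<open>0 < \<phi> x\<close> \<open>\<phi> x \<le> 1\<close> by auto
qed

lemma open_renorm_domain:
  assumes "open A" "A \<subseteq> What"
  shows "open {z. of_real lam * z \<in> A \<and> f (of_real lam * z) \<in> A}"
proof -
  have 1: "open {z. of_real lam * z \<in> A}"
  proof -
    have "open ((\<lambda>z. of_real lam * z) -` A)"
      using assms(1) by (rule open_vimage) (intro continuous_intros)
    then show ?thesis by (simp add: vimage_def)
  qed
  have "continuous_on {z. of_real lam * z \<in> A} (\<lambda>z. f (of_real lam * z))"
    using assms(2) by (intro continuous_on_compose2[OF holomorphic_on_imp_continuous_on[OF holf]]
        continuous_intros) auto
  from continuous_open_preimage[OF this 1 assms(1)] show ?thesis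
    by (simp add: vimage_def Int_def)
qed

lemma holomorphic_renorm:
  assumes "A \<subseteq> What"
  shows "(\<lambda>z. - (1 / of_real lam) * f (f (of_real lam * z)))
     holomorphic_on {z. of_real lam * z \<in> A \<and> f (of_real lam * z) \<in> A}" (is "_ holomorphic_on ?V")
proof -
  have 1: "(\<lambda>z. f (of_real lam * z)) holomorphic_on ?V"
    using holomorphic_on_compose_gen[OF _ holf, of "\<lambda>z. of_real lam * z" ?V] assms
    by (auto simp: o_def intro!: holomorphic_intros)
  have "(\<lambda>z. f (f (of_real lam * z))) holomorphic_on ?V"
    using holomorphic_on_compose_gen[OF 1 holf] assms by (auto simp: o_def)
  then show ?thesis by (intro holomorphic_intros)
qed

text \<open>The renormalization formula continues \<open>f\<close> along \<open>[0, x0 / lam]\<close>, where it decreases from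
  \<open>1\<close> to \<open>- 1 / lam\<close>.  This gives \<open>G\<close> on all of \<open>]- 1 / lam, 1]\<close>.\<close>

lemma G_real_left:
  assumes "- 1 / lam < u" "u \<le> 1"
  obtains x where "0 \<le> x" "x < x0 / lam" "G (of_real u) = of_real (x ^ l)"
proof -
  define k where "k = (\<lambda>x. - (1 / lam) * \<phi> (\<phi> (lam * x)))"
  let ?K = "\<lambda>z. - (1 / of_real lam) * f (f (of_real lam * z))"
  let ?C = "complex_of_real ` {0..<x0 / lam}"
  have rng: "0 \<le> lam * x" "lam * x < x0" if "0 \<le> x" "x < x0 / lam" for x
    using that lam by (auto simp: field_simps)
  have cont: "continuous_on {0..x0 / lam} k"
    unfolding k_def
  proof (intro continuous_intros continuous_on_compose2[OF phi_cont])
    show "(*) lam ` {0..x0 / lam} \<subseteq> {-1..1}"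
    proof
      fix y assume "y \<in> (*) lam ` {0..x0 / lam}"
      then have "0 \<le> y" "y \<le> x0" using lam by (auto simp: field_simps)
      then show "y \<in> {-1..1}" using x0 by simp
    qed
    then show "(\<lambda>x. \<phi> (lam * x)) ` {0..x0 / lam} \<subseteq> {-1..1}"
      using phi_range by fastforce
  qed
  \<comment> \<open>At 0 the two successive values of \<open>\<phi>\<close> are 1 and
    \<open>- lam\<close>; at \<open>x0 / lam\<close> they are 0 and 1.\<close>
  have "k 0 = 1" "k (x0 / lam) = - 1 / lam"
    using lam x0 phi_0 phi_1 by (auto simp: k_def)
  then obtain x where x: "0 \<le> x" "x \<le> x0 / lam" "k x = u"
    using IVT2'[of k "x0 / lam" u 0] cont assms lam x0 by auto
  moreover have "x \<noteq> x0 / lam" using \<open>k (x0 / lam) = _\<close> x assms by auto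
  ultimately have "x < x0 / lam" by simp
  have K: "f (of_real lam * of_real x) = of_real (\<phi> (lam * x))"
          "?K (of_real x) = of_real (k x)" if "0 \<le> x" "x < x0 / lam" for x
  proof -
    note r = rng[OF that] note p = phi_interior[OF r]
    show 1: "f (of_real lam * of_real x) = of_real (\<phi> (lam * x))"
      using f_phi[of "lam * x"] r x0 by simp
    show "?K (of_real x) = of_real (k x)"
      unfolding 1 using f_phi[of "\<phi> (lam * x)"] p by (simp add: k_def)
  qed
  have "G (?K (of_real x)) = of_real x ^ l"
  proof (rule G_eq_power[OF open_renorm_domain[OF openW order_refl] holomorphic_renorm[OF order_refl]])
    show "\<forall>\<^sub>F z in nhds 0. ?K z = f z" using f_eq_near_0 by eventually_elim simp
    show "connected ?C"
      by (intro connected_continuous_image continuous_intros) auto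
    show "0 \<in> ?C" using lam x0 by (intro image_eqI[of _ _ 0]) auto
    show "of_real x \<in> ?C" using x \<open>x < x0 / lam\<close> by auto
    have inW: "complex_of_real y \<in> What" if "-1 \<le> y" "y \<le> 1" for y
      using unit_What that by auto
    show "?C \<subseteq> {z. of_real lam * z \<in> What \<and> f (of_real lam * z) \<in> What}"
    proof safe
      fix y assume y: "y \<in> {0..<x0 / lam}"
      note r = rng[of y] note p = phi_interior[OF r]
      show "of_real lam * complex_of_real y \<in> What"
        using inW[of "lam * y"] r y x0 by simp
      show "f (of_real lam * complex_of_real y) \<in> What"
        using inW[of "\<phi> (lam * y)"] K(1)[of y] p y by simp
    qed
    show "?K ` ?C \<subseteq> slit"
    proof safe
      fix y assume y: "y \<in> {0..<x0 / lam}"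
      note p = phi_interior[OF rng[of y]]
      have "- 1 / lam < k y" "k y \<le> 1"
        using p(3,4) y lam by (auto simp: k_def field_simps)
      moreover have "1 < 1 / lam\<^sup>2" using lam by (auto simp: power_less_one_iff)
      ultimately show "?K (of_real y) \<in> slit"
        using K(2)[of y] y by (simp add: of_real_in_slit_plane)
    qed
  qed
  then have "G (of_real u) = of_real (x ^ l)"
    using K(2)[OF x(1) \<open>x < x0 / lam\<close>] x by simp
  with x \<open>x < x0 / lam\<close> that show ?thesis by blast
qed

text \<open>By reflection and injectivity a solution \<open>w\<close> is real. Up to 1,
  \<open>G\<close> takes only values \<open>y ^ l\<close> with
  \<open>0 \<le> y < x0 / lam < 1 / lam\<close>. Beyond 1 it starts from 0 and would have to pass
  through 1, a value already taken at \<open>- lam\<close>.\<close>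

lemma G_neq_large_power:
  assumes "w \<in> slit" "1 / lam \<le> \<bar>x\<bar>"
  shows "G w \<noteq> of_real (x ^ l)"
proof
  assume eq: "G w = of_real (x ^ l)"
  have xl: "x ^ l = \<bar>x\<bar> ^ l" using l by (simp add: power_even_abs)
  have "Im w = 0" using real_if_G_real[OF assms(1)] eq by simp
  then obtain u where u: "w = of_real u" by (metis complex_is_Real_iff Reals_cases)
  have ub: "- 1 / lam < u" "u < 1 / lam\<^sup>2" using assms u by (auto simp: of_real_in_slit_plane)
  have "1 < 1 / lam" using lam by simp
  show False
  proof (cases "u \<le> 1")
    case True
    then obtain y where y: "0 \<le> y" "y < x0 / lam" "G w = of_real (y ^ l)"
      using G_real_left ub u by blast
    have "x0 / lam < 1 / lam" using x0 lam by (simp add: divide_strict_right_mono)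
    then have "y < \<bar>x\<bar>" using y assms by linarith
    then have "y ^ l < \<bar>x\<bar> ^ l" using y l by (intro power_strict_mono) auto
    moreover have "y ^ l = x ^ l" using eq y(3) of_real_eq_iff by metis
    ultimately show False using xl by simp
  next
    case False
    have sub: "complex_of_real ` {1..u} \<subseteq> slit"
      using ub \<open>1 < 1 / lam\<close> by (auto simp: of_real_in_slit_plane)
    have "continuous_on {1..u} (\<lambda>v. Re (G (of_real v)))"
      using sub by (intro continuous_intros
          continuous_on_compose2[OF holomorphic_on_imp_continuous_on[OF holG]]) auto
    moreover have "Re (G (of_real 1)) = 0" using G_phi[of 0] phi_0 l by simp
    moreover have "1 \<le> Re (G (of_real u))"
      using eq u xl one_le_power[of "\<bar>x\<bar>" l] assms \<open>1 < 1 / lam\<close> by simp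
    ultimately obtain v where v: "1 \<le> v" "v \<le> u" "Re (G (of_real v)) = 1"
      using IVT'[of "\<lambda>v. Re (G (of_real v))" 1 1 u] False by auto
    have "complex_of_real v \<in> slit" using sub v by auto
    moreover have "Im (G (of_real v)) = 0"
      using G_cnj[OF \<open>complex_of_real v \<in> slit\<close>] by (auto simp: complex_eq_iff)
    then have "G (of_real v) = G (of_real (- lam))"
      using v G_phi[of 1] phi_1 by (simp add: complex_eq_iff)
    moreover have "complex_of_real (- lam) \<in> slit"
      by (intro subsetD[OF slit_real] imageI) (use lam in simp)
    ultimately have "complex_of_real v = of_real (- lam)" using inj_onD[OF injG] by blast
    then have "v = - lam" by (simp only: of_real_eq_iff)
    then show False using v lam by simp
  qed
qed


section \<open>The domains \<open>Wn n\<close> and the connectedness of their fibres\<close>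

primrec Wn :: "nat \<Rightarrow> complex set" where
  "Wn 0 = {z. z ^ l \<in> G ` slit}"
| "Wn (Suc n) = {z. of_real lam * z \<in> Wn n \<and> f (of_real lam * z) \<in> Wn n}"

text \<open>\<open>Pn n\<close> is the slit plane scaled by \<open>(- 1 / lam) ^ n\<close>, and \<open>f\<close> will turn out to be a proper
  map from \<open>Wn n\<close> to \<open>Pn n\<close>.\<close>

definition Pn :: "nat \<Rightarrow> complex set" where
  "Pn n = {w. (- of_real lam) ^ n * w \<in> slit}"

text \<open>A real segment that turns out to be mapped into itself by \<open>f\<close>. At level 0
  it contains the critical value 1, and scaling by \<open>lam\<close> takes level
  \<open>Suc n\<close> to level \<open>n\<close>.\<close>

definition Nn :: "nat \<Rightarrow> complex set" where
  "Nn n = complex_of_real ` {- ((1 / lam) ^ n)..(1 / lam) ^ n}"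

text \<open>General bases \<open>X\<close> are allowed because the inductive step takes fibres of
  fibres. The condition \<open>Nn n \<subseteq> X\<close> keeps the critical value in the base at
  level 0 and is compatible with rescaling.\<close>

definition connected_fibres :: "nat \<Rightarrow> bool" where
  "connected_fibres n \<longleftrightarrow>
     (\<forall>X. open X \<and> connected X \<and> Nn n \<subseteq> X \<and> X \<subseteq> Pn n \<longrightarrow> connected {z \<in> Wn n. f z \<in> X})"

lemma G_image: "X \<subseteq> slit \<Longrightarrow> open X \<Longrightarrow> open (G ` X)"
  by (intro open_mapping_thm3 holomorphic_on_subset[OF holG] inj_on_subset[OF injG])

lemma G_1: "G 1 = 0"
  using G_phi[of 0] phi_0 l by simp

lemma holF: "F holomorphic_on G ` slit"
proof -
  obtain g where g: "g holomorphic_on G ` slit" "\<And>z. z \<in> slit \<Longrightarrow> g (G z) = z"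
    using holomorphic_has_inverse[OF holG open_slit_plane injG] by metis
  have "g u = F u" if "u \<in> G ` slit" for u using that g(2) FG by auto
  with g(1) show ?thesis by (rule holomorphic_transform)
qed

lemma connected_power_vimage_G:
  assumes "open X" "connected X" "1 \<in> X" "X \<subseteq> slit"
  shows "connected {z. z ^ l \<in> G ` X}"
proof (rule connected_power_vimage)
  show "connected (G ` X)"
    by (intro connected_continuous_image holomorphic_on_imp_continuous_on
        holomorphic_on_subset[OF holG] assms)
  show "0 \<in> G ` X" using assms G_1 by (metis imageI)
qed (use l assms G_image in auto)

lemma one_in_slit: "1 \<in> slit"
  using subsetD[OF slit_real, of "of_real 1"] by auto

lemma open_Wn_0: "open (Wn 0)"
proof -
  have "open ((\<lambda>z. z ^ l) -` (G ` slit))"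
    using G_image[OF order_refl open_slit_plane] by (rule open_vimage) (intro continuous_intros)
  then show ?thesis by (simp add: vimage_def)
qed

text \<open>Maximality applies to \<open>F (z ^ l)\<close>, which is holomorphic on the connected
  set \<open>Wn 0\<close> and agrees with \<open>f\<close> near 0.\<close>

lemma Wn_0: "Wn 0 \<subseteq> What" "\<And>z. z \<in> Wn 0 \<Longrightarrow> f z = F (z ^ l)"
proof -
  have conn: "connected (Wn 0)"
    using connected_power_vimage_G[OF open_slit_plane connected_slit_plane[OF lam(1)] one_in_slit]
    by simp
  have "0 \<in> Wn 0" using imageI[OF one_in_slit, of G] G_1 l by (simp add: zero_power)
  moreover have "(\<lambda>z. F (z ^ l)) holomorphic_on Wn 0"
  proof -
    have "(\<lambda>z. z ^ l) holomorphic_on Wn 0" by (intro holomorphic_intros)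
    from holomorphic_on_compose_gen[OF this holF] show ?thesis by (auto simp: o_def)
  qed
  moreover have "\<forall>\<^sub>F z in nhds 0. F (z ^ l) = f z"
    using f_F_near_0 by eventually_elim auto
  ultimately have "Wn 0 \<subseteq> What \<and> (\<forall>z\<in>Wn 0. F (z ^ l) = f z)"
    by (intro ext[OF open_Wn_0 conn])
  then show "Wn 0 \<subseteq> What" "\<And>z. z \<in> Wn 0 \<Longrightarrow> f z = F (z ^ l)" by auto
qed

lemma f_Wn_0:
  assumes "z \<in> Wn 0" shows "f z \<in> slit" "G (f z) = z ^ l"
proof -
  obtain w where "w \<in> slit" "z ^ l = G w" using assms by auto
  then show "f z \<in> slit" "G (f z) = z ^ l" using Wn_0(2)[OF assms] FG by simp_all
qed

text \<open>Evenness of \<open>l\<close> makes \<open>Wn 0\<close> symmetric, so it avoids the rays on both sides at distance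
  \<open>1 / lam\<close>, hence also the shorter slit starting at \<open>1 / lam\<^sup>2\<close>.\<close>

lemma Wn_0_subset:
  assumes "z \<in> Wn 0" shows "z \<in> slit" "- z \<in> slit"
proof -
  have le: "1 / lam \<le> 1 / lam\<^sup>2"
    using lam by (simp add: field_simps power2_eq_square)
  have False if "\<bar>Re z\<bar> \<ge> 1 / lam" "Im z = 0"
  proof -
    from assms obtain w where w: "w \<in> slit" "z ^ l = G w" by auto
    have "of_real (Re z) = z" using that by (simp add: complex_eq_iff)
    then have "of_real (Re z ^ l) = z ^ l" by (simp only: of_real_power)
    then show False using G_neq_large_power[OF w(1) that(1)] w(2) by simp
  qed
  then have "\<not> (1 / lam \<le> \<bar>Re z\<bar> \<and> Im z = 0)" by blast
  with le show "z \<in> slit" "- z \<in> slit"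
    unfolding slit_plane_iff uminus_complex.sel by linarith+
qed

lemma Pn_Suc: "w \<in> Pn (Suc n) \<longleftrightarrow> - of_real lam * w \<in> Pn n"
  by (simp only: Pn_def mem_Collect_eq power_Suc2 mult.assoc)

text \<open>Both signs are carried along because \<open>Pn (Suc n)\<close> arises from
  \<open>Pn n\<close> by the negative factor \<open>- 1 / lam\<close>, whereas
  \<open>Wn (Suc n)\<close> is defined with the positive factor \<open>lam\<close>.\<close>

lemma Wn_subset_Pn:
  "z \<in> Wn n \<Longrightarrow> z \<in> Pn n \<and> - z \<in> Pn n"
proof (induction n arbitrary: z)
  case 0
  then show ?case using Wn_0_subset[OF 0] by (simp add: Pn_def)
next
  case (Suc n)
  then show ?case using Suc.IH[of "of_real lam * z"] by (simp add: Pn_Suc)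
qed

lemma Nn_Suc: "x \<in> Nn (Suc n) \<longleftrightarrow> of_real lam * x \<in> Nn n"
proof
  assume "x \<in> Nn (Suc n)"
  then obtain r where "x = of_real r" "- ((1 / lam) ^ Suc n) \<le> r" "r \<le> (1 / lam) ^ Suc n"
    by (auto simp: Nn_def)
  then show "of_real lam * x \<in> Nn n"
    unfolding Nn_def using lam by (intro image_eqI[of _ _ "lam * r"]) (auto simp: field_simps)
next
  assume "of_real lam * x \<in> Nn n"
  then obtain r where r: "of_real lam * x = of_real r" "- ((1 / lam) ^ n) \<le> r" "r \<le> (1 / lam) ^ n"
    by (auto simp: Nn_def)
  then have "x = of_real (r / lam)" using lam by (simp add: field_simps)
  then show "x \<in> Nn (Suc n)"
    unfolding Nn_def using lam r by (intro image_eqI[of _ _ "r / lam"]) (auto simp: field_simps)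
qed

lemma Nn_minus: "- x \<in> Nn n \<longleftrightarrow> x \<in> Nn n"
proof -
  have "- y \<in> Nn n" if "y \<in> Nn n" for y
  proof -
    obtain r where "y = of_real r" "- ((1 / lam) ^ n) \<le> r" "r \<le> (1 / lam) ^ n"
      using \<open>y \<in> Nn n\<close> by (auto simp: Nn_def)
    then show ?thesis unfolding Nn_def by (intro image_eqI[of _ _ "- r"]) auto
  qed
  from this[of x] this[of "- x"] show ?thesis by auto
qed

lemma zero_in_Nn: "0 \<in> Nn n"
  unfolding Nn_def using lam by (intro image_eqI[of _ _ 0]) auto

lemma connected_fibres_0: "connected_fibres 0"
  unfolding connected_fibres_def
proof (intro allI impI)
  fix X assume X: "open X \<and> connected X \<and> Nn 0 \<subseteq> X \<and> X \<subseteq> Pn 0"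
  then have "X \<subseteq> slit" by (simp add: Pn_def)
  have "1 \<in> Nn 0" unfolding Nn_def by (rule image_eqI[of _ _ 1]) auto
  have "{z \<in> Wn 0. f z \<in> X} = {z. z ^ l \<in> G ` X}"
  proof safe
    fix z assume "z \<in> Wn 0" "f z \<in> X"
    then show "z ^ l \<in> G ` X" using f_Wn_0 by (metis imageI)
  next
    fix z x assume z: "z ^ l = G x" "x \<in> X"
    then show *: "z \<in> Wn 0" using \<open>X \<subseteq> slit\<close> by auto
    show "f z \<in> X" using Wn_0(2)[OF *] z FG \<open>X \<subseteq> slit\<close> by auto
  qed
  with X \<open>X \<subseteq> slit\<close> \<open>1 \<in> Nn 0\<close> show "connected {z \<in> Wn 0. f z \<in> X}"
    using connected_power_vimage_G by auto
qed

lemma open_fibre: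
  assumes "open A" "A \<subseteq> What" "open X"
  shows "open {z \<in> A. f z \<in> X}"
  using continuous_open_preimage[OF holomorphic_on_imp_continuous_on[OF holomorphic_on_subset[OF holf assms(2)]] assms(1,3)]
  by (simp add: vimage_def Int_def)

text \<open>By \<open>feq\<close>, the fibre over \<open>X\<close> is \<open>1 / lam\<close> times
  the fibre over the fibre over \<open>X' = - lam * X\<close>. The inner fibre is again an
  admissible base: it contains \<open>Nn n\<close> by invariance and lies in \<open>Wn n\<close>,
  hence in \<open>Pn n\<close>. So the induction hypothesis applies twice.\<close>

lemma connected_fibres_Suc:
  assumes W: "open (Wn n)" "Wn n \<subseteq> What" "Nn n \<subseteq> Wn n" "f ` Nn n \<subseteq> Nn n"
    and IH: "connected_fibres n"
    and feq: "\<And>z. z \<in> Wn (Suc n) \<Longrightarrow> f (f (of_real lam * z)) = - of_real lam * f z"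
  shows "connected_fibres (Suc n)"
  unfolding connected_fibres_def
proof (intro allI impI)
  fix X assume X: "open X \<and> connected X \<and> Nn (Suc n) \<subseteq> X \<and> X \<subseteq> Pn (Suc n)"
  define X' where "X' = (\<lambda>w. - of_real lam * w) ` X"
  have lam0: "- complex_of_real lam \<noteq> 0" using lam by simp
  have X'_iff: "w \<in> X' \<longleftrightarrow> - (w / of_real lam) \<in> X" for w
    using lam by (force simp: X'_def image_iff field_simps)
  have fibre: "connected {z \<in> Wn n. f z \<in> Y}"
    if "open Y" "connected Y" "Nn n \<subseteq> Y" "Y \<subseteq> Pn n" for Y
    using IH that by (auto simp: connected_fibres_def)
  have "open X'" unfolding X'_def using X open_scaling[of "- lam" X] lam0
    by (simp add: scaleR_conv_of_real)
  moreover have "connected X'" unfolding X'_def using X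
    by (intro connected_continuous_image continuous_intros) auto
  moreover have "Nn n \<subseteq> X'"
  proof
    fix w assume "w \<in> Nn n"
    then have "- (w / of_real lam) \<in> Nn (Suc n)" using lam by (simp add: Nn_Suc Nn_minus)
    then show "w \<in> X'" using X by (auto simp: X'_iff)
  qed
  moreover have "X' \<subseteq> Pn n"
    using X Pn_Suc by (auto simp: X'_def)
  ultimately have Y: "connected {z \<in> Wn n. f z \<in> X'}" "open {z \<in> Wn n. f z \<in> X'}"
      "Nn n \<subseteq> {z \<in> Wn n. f z \<in> X'}"
    using fibre open_fibre W by auto
  have Z: "connected {z \<in> Wn n. f z \<in> {z \<in> Wn n. f z \<in> X'}}"
    using Wn_subset_Pn by (intro fibre Y) auto
  have "{z \<in> Wn (Suc n). f z \<in> X} = (\<lambda>z. z / of_real lam) ` {z \<in> Wn n. f z \<in> {z \<in> Wn n. f z \<in> X'}}"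
    (is "?L = ?R")
  proof (intro set_eqI iffI)
    fix z assume z: "z \<in> ?L"
    then have "f (f (of_real lam * z)) \<in> X'"
      using feq[of z] lam by (simp add: X'_iff)
    with z show "z \<in> ?R"
      using lam by (intro image_eqI[of _ _ "of_real lam * z"]) auto
  next
    fix z assume "z \<in> ?R"
    then have z: "of_real lam * z \<in> Wn n" "f (of_real lam * z) \<in> Wn n" "f (f (of_real lam * z)) \<in> X'"
      using lam by auto
    then show "z \<in> ?L"
      using feq[of z] lam by (simp add: X'_iff)
  qed
  moreover have "connected ?R"
    using lam by (intro connected_continuous_image Z continuous_intros) auto
  ultimately show "connected ?L" by simp
qed

text \<open>The renormalization formula is a holomorphic function on \<open>Wn (Suc n)\<close> with
  the germ of \<open>f\<close> at 0. Maximality then gives the inclusion, and also the functional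
  equation beyond a neighbourhood of 0.\<close>

lemma Wn_extends:
  assumes "open (Wn n)" "Wn n \<subseteq> What" "connected (Wn (Suc n))" "0 \<in> Wn (Suc n)"
  shows "Wn (Suc n) \<subseteq> What"
    and "\<And>z. z \<in> Wn (Suc n) \<Longrightarrow> f (f (of_real lam * z)) = - of_real lam * f z"
proof -
  let ?h = "\<lambda>z. - (1 / of_real lam) * f (f (of_real lam * z))"
  have "\<forall>\<^sub>F z in nhds 0. ?h z = f z" using f_eq_near_0 by eventually_elim simp
  then have *: "Wn (Suc n) \<subseteq> What \<and> (\<forall>z\<in>Wn (Suc n). ?h z = f z)"
    using open_renorm_domain[OF assms(1,2)] holomorphic_renorm[OF assms(2)] assms(3,4)
    by (intro ext) simp_all
  then show "Wn (Suc n) \<subseteq> What" by simp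
  fix z assume "z \<in> Wn (Suc n)"
  with * have "?h z = f z" by blast
  then have "f z = ?h z" by simp
  then show "f (f (of_real lam * z)) = - of_real lam * f z"
    using lam by simp
qed

text \<open>The properties need a joint induction: fibres at level \<open>n\<close> make
  \<open>Wn (Suc n)\<close> connected, which allows maximality to be used, and the resulting
  functional equation gives the fibres at level \<open>Suc n\<close>.\<close>

lemma Wn_invariant:
  "open (Wn n) \<and> connected (Wn n) \<and> Wn n \<subseteq> What \<and> Nn n \<subseteq> Wn n \<and> f ` Nn n \<subseteq> Nn n \<and>
   connected_fibres n"
proof (induction n)
  case 0
  have "connected (Wn 0)"
    using connected_power_vimage_G[OF open_slit_plane connected_slit_plane[OF lam(1)] one_in_slit]
    by simp
  moreover have "Nn 0 \<subseteq> Wn 0"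
  proof
    fix z assume "z \<in> Nn 0"
    then obtain x where x: "z = of_real x" "-1 \<le> x" "x \<le> 1" by (auto simp: Nn_def)
    have "complex_of_real (\<phi> x) \<in> slit"
      using phi_range[of x] x by (intro subsetD[OF slit_real] imageI) auto
    then show "z \<in> Wn 0" using G_phi[of x] x by (auto simp: image_iff intro!: bexI)
  qed
  moreover have "f ` Nn 0 \<subseteq> Nn 0"
    using f_phi phi_range by (fastforce simp: Nn_def)
  ultimately show ?case using open_Wn_0 Wn_0 connected_fibres_0 by auto
next
  case (Suc n)
  then have IH: "open (Wn n)" "connected (Wn n)" "Wn n \<subseteq> What" "Nn n \<subseteq> Wn n" "f ` Nn n \<subseteq> Nn n"
    "connected_fibres n" by auto
  have opn: "open (Wn (Suc n))" using open_renorm_domain[OF IH(1,3)] by simp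
  have N: "Nn (Suc n) \<subseteq> Wn (Suc n)"
    using subsetD[OF IH(4)] subsetD[OF IH(5)] by (auto simp: Nn_Suc)
  \<comment> \<open>\<open>Wn n\<close> is itself an admissible base, and the fibre over it is
    \<open>lam * Wn (Suc n)\<close>.\<close>
  have "connected {z \<in> Wn n. f z \<in> Wn n}"
    using IH(1-4,6) Wn_subset_Pn by (auto simp: connected_fibres_def)
  then have "connected ((\<lambda>z. z / of_real lam) ` {z \<in> Wn n. f z \<in> Wn n})"
    using lam by (intro connected_continuous_image continuous_intros) auto
  also have "(\<lambda>z. z / of_real lam) ` {z \<in> Wn n. f z \<in> Wn n} = Wn (Suc n)"
  proof (intro set_eqI iffI)
    fix z assume "z \<in> Wn (Suc n)"
    then show "z \<in> (\<lambda>z. z / of_real lam) ` {z \<in> Wn n. f z \<in> Wn n}"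
      using lam by (intro image_eqI[of _ _ "of_real lam * z"]) auto
  qed (use lam in auto)
  finally have conn: "connected (Wn (Suc n))" .
  note E = Wn_extends[OF IH(1,3) conn subsetD[OF N zero_in_Nn]]
  have "f x \<in> Nn (Suc n)" if "x \<in> Nn (Suc n)" for x
  proof -
    have "f (f (of_real lam * x)) \<in> Nn n" using that IH(5) by (auto simp: Nn_Suc)
    then show ?thesis using E(2)[of x] N that by (auto simp: Nn_Suc Nn_minus)
  qed
  then show ?case
    using opn conn E N connected_fibres_Suc[OF IH(1,3,4,5,6) E(2)] by auto
qed

section \<open>Properness of \<open>f\<close> on \<open>Wn n\<close> and exhaustion of
  \<open>What\<close>\<close>

lemma Wn_subset: "Wn n \<subseteq> What" and open_Wn: "open (Wn n)"
  and zero_in_Wn: "0 \<in> Wn n"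
  using Wn_invariant[of n] zero_in_Nn by auto

lemma f_eq_Wn: "z \<in> Wn (Suc n) \<Longrightarrow> f (f (of_real lam * z)) = - of_real lam * f z"
  using Wn_extends(2)[OF open_Wn Wn_subset _ zero_in_Wn] Wn_invariant by blast

text \<open>At level 0 this is continuity of \<open>G\<close> and properness of the power map. At
  level \<open>Suc n\<close> the values \<open>f (f (lam * z j))\<close> converge, so the induction
  hypothesis applies first to the points \<open>f (lam * z j)\<close> and then to
  \<open>lam * z j\<close>.\<close>

lemma Wn_proper:
  assumes "\<And>j. z j \<in> Wn n" "(\<lambda>j. f (z j)) \<longlonglongrightarrow> a" "a \<in> Pn n"
  obtains c r where "c \<in> Wn n" "strict_mono r" "(z \<circ> r) \<longlonglongrightarrow> c"
  using assms
proof (induction n arbitrary: z a thesis)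
  case 0
  have "isCont G a"
    using 0(4) by (intro holomorphic_on_imp_isCont[OF holG open_slit_plane]) (simp add: Pn_def)
  then have "(\<lambda>j. G (f (z j))) \<longlonglongrightarrow> G a" using 0(3) by (rule isCont_tendsto_compose)
  then have "(\<lambda>j. z j ^ l) \<longlonglongrightarrow> G a" using f_Wn_0 0(2) by simp
  then obtain c r where c: "strict_mono r" "(z \<circ> r) \<longlonglongrightarrow> c" "c ^ l = G a"
    using power_tendsto_subseq[OF l(2)] by blast
  then have "c \<in> Wn 0" using 0(4) by (auto simp: Pn_def)
  with c 0(1) show ?case by blast
next
  case (Suc n)
  define y where "y = (\<lambda>j. of_real lam * z j)"
  have y: "y j \<in> Wn n" "f (y j) \<in> Wn n" for j using Suc.prems(2)[of j] by (auto simp: y_def)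
  have "(\<lambda>j. - of_real lam * f (z j)) \<longlonglongrightarrow> - of_real lam * a"
    using Suc.prems(3) by (intro tendsto_intros)
  then have "(\<lambda>j. f (f (y j))) \<longlonglongrightarrow> - of_real lam * a"
    using f_eq_Wn[OF Suc.prems(2)] by (simp add: y_def)
  moreover have "- of_real lam * a \<in> Pn n" using Suc.prems(4) Pn_Suc by blast
  ultimately obtain b r where b: "b \<in> Wn n" "strict_mono r" "((\<lambda>j. f (y j)) \<circ> r) \<longlonglongrightarrow> b"
    using Suc.IH[where z = "\<lambda>j. f (y j)" and a = "- of_real lam * a"] y by blast
  have "(\<lambda>j. f ((y \<circ> r) j)) \<longlonglongrightarrow> b" "b \<in> Pn n"
    using b Wn_subset_Pn by (auto simp: o_def)
  then obtain c s where c: "c \<in> Wn n" "strict_mono s" "((y \<circ> r) \<circ> s) \<longlonglongrightarrow> c"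
    using Suc.IH[where z = "y \<circ> r" and a = b] y by (metis comp_apply)
  have "isCont f c"
    using c(1) Wn_subset by (intro holomorphic_on_imp_isCont[OF holf openW]) auto
  then have "(\<lambda>j. f (((y \<circ> r) \<circ> s) j)) \<longlonglongrightarrow> f c" using c(3) by (rule isCont_tendsto_compose)
  moreover have "(\<lambda>j. f (((y \<circ> r) \<circ> s) j)) \<longlonglongrightarrow> b"
    using LIMSEQ_subseq_LIMSEQ[OF b(3) c(2)] by (simp add: o_def)
  \<comment> \<open>Identifying the two limits gives \<open>f c \<in> Wn n\<close>, the second
    condition for \<open>c / lam\<close> to lie in \<open>Wn (Suc n)\<close>.\<close>
  ultimately have "f c = b" by (rule LIMSEQ_unique)
  then have "c / of_real lam \<in> Wn (Suc n)" using b(1) c(1) lam by simp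
  moreover have "strict_mono (r \<circ> s)" using b(2) c(2) by (rule strict_mono_o)
  moreover have "(z \<circ> (r \<circ> s)) \<longlonglongrightarrow> c / of_real lam"
  proof -
    have "(\<lambda>j. ((y \<circ> r) \<circ> s) j / of_real lam) \<longlonglongrightarrow> c / of_real lam"
      by (rule tendsto_divide[OF c(3) tendsto_const]) (use lam in simp)
    then show ?thesis using lam by (simp add: y_def o_def)
  qed
  ultimately show ?case using Suc.prems(1) by blast
qed

text \<open>Multiplication by \<open>(- lam) ^ n\<close> eventually shrinks \<open>K\<close> into
  the unit disc, which misses both slits.\<close>

lemma eventually_in_Pn:
  assumes "bounded K"
  shows "\<forall>\<^sub>F n in sequentially. K \<subseteq> Pn n"
proof -
  obtain B where B: "B > 0" "\<And>x. x \<in> K \<Longrightarrow> norm x \<le> B"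
    using assms by (auto simp: bounded_pos)
  have "(\<lambda>n. lam ^ n) \<longlonglongrightarrow> 0" using lam by (intro LIMSEQ_realpow_zero) auto
  then have "\<forall>\<^sub>F n in sequentially. lam ^ n < 1 / B"
    using B(1) by (intro order_tendstoD) auto
  then show ?thesis
  proof eventually_elim
    case (elim n)
    show ?case
    proof
      fix x assume "x \<in> K"
      have "norm ((- of_real lam) ^ n * x) = lam ^ n * norm x"
        using lam by (simp add: norm_mult norm_power)
      also have "\<dots> \<le> lam ^ n * B" using B(2)[OF \<open>x \<in> K\<close>] lam by (intro mult_left_mono) auto
      also have "\<dots> < 1" using elim B(1) by (simp add: field_simps)
      finally have *: "\<bar>Re ((- of_real lam) ^ n * x)\<bar> < 1"
        using abs_Re_le_cmod le_less_trans by blast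
      have "1 < 1 / lam" "1 < 1 / lam\<^sup>2" using lam by (auto simp: power_less_one_iff)
      then show "x \<in> Pn n" using * unfolding Pn_def mem_Collect_eq slit_plane_iff by linarith
    qed
  qed
qed

text \<open>By properness \<open>Wn n\<close> is relatively closed in the part of \<open>What\<close> that \<open>f\<close> maps
  into \<open>Pn n\<close>, so it swallows every connected subset through \<open>0\<close>.\<close>

lemma eventually_in_Wn:
  assumes "z \<in> What"
  shows "\<forall>\<^sub>F n in sequentially. z \<in> Wn n"
proof -
  \<comment> \<open>A path supplies a compact connected set, so that its image under
    \<open>f\<close> is bounded and lies in \<open>Pn n\<close> for large \<open>n\<close>.\<close>
  have "path_connected What" using openW connW by (simp add: connected_open_path_connected)
  moreover have "0 \<in> What" using zero_in_Wn Wn_subset by blast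
  ultimately obtain p where p: "path p" "path_image p \<subseteq> What" "pathstart p = 0" "pathfinish p = z"
    using assms unfolding path_connected_def by blast
  define K where "K = path_image p"
  have K: "compact K" "connected K" "0 \<in> K" "z \<in> K" "K \<subseteq> What"
    using p pathstart_in_path_image[of p] pathfinish_in_path_image[of p]
    by (auto simp: K_def compact_path_image connected_path_image)
  have contK: "continuous_on K f" using K holf
    by (meson continuous_on_subset holomorphic_on_imp_continuous_on)
  then have "bounded (f ` K)" using K(1) by (intro compact_imp_bounded compact_continuous_image)
  from eventually_in_Pn[OF this] show ?thesis
  proof eventually_elim
    case (elim n)
    have "openin (top_of_set K) (K \<inter> Wn n)" using open_Wn by (simp add: openin_open_Int)
    moreover have "closedin (top_of_set K) (K \<inter> Wn n)"
      unfolding closedin_limpt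
    proof (intro conjI allI impI)
      fix x assume x: "x islimpt K \<inter> Wn n \<and> x \<in> K"
      then obtain y where y: "\<And>j::nat. y j \<in> K \<inter> Wn n" "y \<longlonglongrightarrow> x"
        by (meson DiffE islimpt_sequential)
      then have "(\<lambda>j. f (y j)) \<longlonglongrightarrow> f x"
        using contK x by (intro continuous_on_tendsto_compose[OF contK]) auto
      moreover have "f x \<in> Pn n" using x elim by blast
      ultimately obtain c r where c: "c \<in> Wn n" "strict_mono r" "(y \<circ> r) \<longlonglongrightarrow> c"
        using Wn_proper[of y n "f x"] y by blast
      then have "x = c" using LIMSEQ_subseq_LIMSEQ[OF y(2)] LIMSEQ_unique by blast
      with c x show "x \<in> K \<inter> Wn n" by blast
    qed auto
    ultimately have "K \<inter> Wn n = K"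
      using K(2,3) zero_in_Wn[of n] unfolding connected_clopen by blast
    then show "z \<in> Wn n" using K(4) by blast
  qed
qed

text \<open>Exhaustion reduces this to the recursion defining \<open>Wn\<close>. One direction keeps
  orbits inside \<open>What\<close>; the other pulls membership back along an orbit.\<close>

lemma What_iff: "z \<in> What \<longleftrightarrow> of_real lam * z \<in> What \<and> f (of_real lam * z) \<in> What"
proof
  assume "z \<in> What"
  then obtain N where N: "\<And>n. n \<ge> N \<Longrightarrow> z \<in> Wn n"
    using eventually_in_Wn unfolding eventually_sequentially by blast
  from N[of "Suc N"] show "of_real lam * z \<in> What \<and> f (of_real lam * z) \<in> What"
    using Wn_subset by auto
next
  assume *: "of_real lam * z \<in> What \<and> f (of_real lam * z) \<in> What"
  then have "\<forall>\<^sub>F n in sequentially. of_real lam * z \<in> Wn n \<and> f (of_real lam * z) \<in> Wn n"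
    using eventually_in_Wn by (simp add: eventually_conj)
  then obtain n where "z \<in> Wn (Suc n)"
    unfolding eventually_sequentially by auto
  then show "z \<in> What" using Wn_subset by blast
qed

section \<open>Convergence of orbits and the basin\<close>

definition g :: "complex \<Rightarrow> complex" where "g = (\<lambda>z. f (of_real lam * z))"

text \<open>Each application of \<open>g\<close> costs one level of \<open>Wn\<close> and, by the
  functional equation, multiplies \<open>f\<close> by \<open>- lam\<close>.\<close>

lemma f_iterate:
  assumes "z \<in> Wn (m + n)"
  shows "(g ^^ n) z \<in> Wn m" "f ((g ^^ n) z) = (- of_real lam) ^ n * f z"
proof -
  have "(g ^^ n) z \<in> Wn m \<and> f ((g ^^ n) z) = (- of_real lam) ^ n * f z"
    using assms
  proof (induction n arbitrary: m)
    case (Suc n)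
    then have IH: "(g ^^ n) z \<in> Wn (Suc m)" "f ((g ^^ n) z) = (- of_real lam) ^ n * f z"
      by (metis add_Suc add_Suc_right)+
    then show ?case using f_eq_Wn[OF IH(1)] by (simp add: g_def)
  qed simp
  then show "(g ^^ n) z \<in> Wn m" "f ((g ^^ n) z) = (- of_real lam) ^ n * f z" by auto
qed

lemma x0_power: "G 0 = of_real x0 ^ l"
  using G_phi[of x0] x0 by simp

text \<open>Along an orbit in \<open>What\<close> the values of \<open>f\<close> tend to \<open>0\<close>, so the \<open>l\<close>-th powers tend to
  \<open>x0 ^ l\<close>; as \<open>f\<close> only depends on the \<open>l\<close>-th power on \<open>Wn 0\<close>, one more iteration removes the
  ambiguity of the root of unity.\<close>

lemma iterate_tendsto:
  assumes "z \<in> What"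
  shows "(\<lambda>n. (g ^^ n) z) \<longlonglongrightarrow> of_real x0"
proof -
  obtain N where N: "\<And>n. n \<ge> N \<Longrightarrow> z \<in> Wn n"
    using eventually_in_Wn[OF assms] unfolding eventually_sequentially by blast
  have "(\<lambda>n. (- complex_of_real lam) ^ n) \<longlonglongrightarrow> 0"
    using lam by (intro LIMSEQ_power_zero) simp
  then have "(\<lambda>n. (- of_real lam) ^ n * f z) \<longlonglongrightarrow> 0"
    by (intro tendsto_mult_left_zero)
  moreover have "isCont G 0"
    using lam by (intro holomorphic_on_imp_isCont[OF holG open_slit_plane]) (simp add: slit_plane_iff)
  ultimately have "(\<lambda>n. G ((- of_real lam) ^ n * f z)) \<longlonglongrightarrow> G 0"
    by (rule isCont_tendsto_compose[rotated])
  \<comment> \<open>The factor \<open>lam ^ l\<close> produces the argument at which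
    \<open>F\<close> gives the next iterate.\<close>
  then have "(\<lambda>n. (of_real lam) ^ l * G ((- of_real lam) ^ n * f z)) \<longlonglongrightarrow> of_real lam ^ l * of_real x0 ^ l"
    unfolding x0_power by (intro tendsto_intros)
  moreover have "\<forall>\<^sub>F n in sequentially.
     of_real lam ^ l * G ((- of_real lam) ^ n * f z) = (of_real lam * (g ^^ n) z) ^ l"
    using eventually_ge_at_top[of N]
  proof eventually_elim
    case (elim n)
    note it = f_iterate[of z 0 n]
    show ?case using it N[of n] elim f_Wn_0(2)[of "(g ^^ n) z"] by (simp add: power_mult_distrib)
  qed
  ultimately have lim: "(\<lambda>n. (of_real lam * (g ^^ n) z) ^ l) \<longlonglongrightarrow> of_real (lam * x0) ^ l"
    by (auto simp: power_mult_distrib elim: Lim_transform_eventually)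
  have bd: "0 \<le> lam * x0" "lam * x0 \<le> 1" using lam x0 by (auto intro: mult_le_one)
  then have mem: "of_real (lam * x0) \<in> Nn 0" unfolding Nn_def by (intro imageI) simp
  then have inW: "complex_of_real (lam * x0) \<in> Wn 0" using Wn_invariant by blast
  then have "isCont F (of_real (lam * x0) ^ l)"
    by (intro holomorphic_on_imp_isCont[OF holF G_image[OF order_refl open_slit_plane]]) simp
  then have "(\<lambda>n. F ((of_real lam * (g ^^ n) z) ^ l)) \<longlonglongrightarrow> F (of_real (lam * x0) ^ l)"
    using lim by (rule isCont_tendsto_compose)
  moreover have "F (of_real (lam * x0) ^ l) = of_real x0"
    using Wn_0(2)[OF inW] f_phi[of "lam * x0"] bd phi_lam_x0 by (simp del: of_real_mult)
  moreover have "\<forall>\<^sub>F n in sequentially. F ((of_real lam * (g ^^ n) z) ^ l) = (g ^^ Suc n) z"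
    using eventually_ge_at_top[of N]
  proof eventually_elim
    case (elim n)
    \<comment> \<open>The extra level is needed because \<open>g ^^ n\<close> must land in
      \<open>Wn 1\<close> for its multiple by \<open>lam\<close> to lie in
      \<open>Wn 0\<close>.\<close>
    have "of_real lam * (g ^^ n) z \<in> Wn 0"
      using f_iterate(1)[of z 1 n] N[of "1 + n"] elim by simp
    then show ?case using Wn_0(2) by (simp add: g_def)
  qed
  ultimately have "(\<lambda>n. (g ^^ Suc n) z) \<longlonglongrightarrow> of_real x0"
    by (auto elim: Lim_transform_eventually)
  then show ?thesis by (rule LIMSEQ_imp_Suc)
qed

lemma What_eq_basin:
  "What = basin_of_attraction (\<lambda>z. f (of_real lam * z)) ((\<lambda>z. z / of_real lam) ` What) (of_real x0)"
proof -
  have dom: "z \<in> (\<lambda>z. z / of_real lam) ` What \<longleftrightarrow> of_real lam * z \<in> What" for z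
    using lam by (auto intro!: image_eqI[of _ _ "of_real lam * z"])
  have "z \<in> What \<longleftrightarrow> (\<forall>n. of_real lam * (g ^^ n) z \<in> What) \<and> (\<lambda>n. (g ^^ n) z) \<longlonglongrightarrow> of_real x0" for z
  proof (intro iffI conjI allI)
    fix n assume "z \<in> What"
    then have "(g ^^ n) z \<in> What"
    proof (induction n)
      case (Suc n)
      then show ?case using What_iff[of "(g ^^ n) z"] by (simp add: g_def)
    qed simp
    then show "of_real lam * (g ^^ n) z \<in> What" using What_iff by blast
  next
    assume "z \<in> What" then show "(\<lambda>n. (g ^^ n) z) \<longlonglongrightarrow> of_real x0" by (rule iterate_tendsto)
  next
    assume *: "(\<forall>n. of_real lam * (g ^^ n) z \<in> What) \<and> (\<lambda>n. (g ^^ n) z) \<longlonglongrightarrow> of_real x0"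
    \<comment> \<open>\<open>What\<close> is a neighbourhood of \<open>x0\<close>, so a convergent
      orbit enters it; the domain condition then permits pulling back one iterate at a time.\<close>
    have "of_real x0 \<in> What" using unit_What x0 by (intro subsetD[OF unit_What] imageI) auto
    then have "\<forall>\<^sub>F n in sequentially. (g ^^ n) z \<in> What"
      using * openW topological_tendstoD by blast
    then obtain n where "(g ^^ n) z \<in> What" unfolding eventually_sequentially by blast
    then show "z \<in> What"
    proof (induction n)
      case (Suc n)
      then show ?case using * What_iff[of "(g ^^ n) z"] by (simp add: g_def)
    qed simp
  qed
  then show ?thesis unfolding basin_of_attraction_def dom g_def by blast
qed

end

section \<open>The zero of \<open>\<phi>\<close> and the passage to the locale\<close>

lemma feigenbaum_map_phi:
  assumes "pd_fixed_point l \<phi>" "\<phi> 1 = - lam" "0 < lam" "lam < 1"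
  obtains y where "0 < y" "y < 1" "\<phi> y = 0" "\<phi> (lam * y) = y"
    "\<And>x. 0 < x \<Longrightarrow> x \<le> 1 \<Longrightarrow> \<phi> x = 0 \<Longrightarrow> x = y"
proof -
  from assms have u: "continuous_on {-1..1} \<phi>" "\<phi> ` {-1..1} \<subseteq> {-1..1}" "\<phi> 0 = 1"
      "strict_antimono_on {0..1} \<phi>"
    and scale: "pd_scale \<phi> = lam" and ren: "pd_renormalizable \<phi>"
    and fix_eq: "\<And>x. x \<in> {-1..1} \<Longrightarrow> pd_renorm \<phi> x = \<phi> x"
    by (auto simp: pd_fixed_point_def unimodal_def pd_scale_def)
  note anti = monotone_onD[OF u(4)]
  obtain y where y: "0 \<le> y" "y \<le> 1" "\<phi> y = 0"
    using IVT2'[of \<phi> 1 0 0] assms u continuous_on_subset[OF u(1), of "{0..1}"] by auto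
  then have y': "0 < y" "y < 1" using u assms by (auto simp: less_le)
  have uniq: "x = y" if "0 < x" "x \<le> 1" "\<phi> x = 0" for x
    using anti[of x y] anti[of y x] that y by (cases x y rule: linorder_cases) auto
  have ly: "0 < lam * y" "lam * y < lam" "lam * y < 1"
    using y' assms mult_strict_mono[of lam 1 y 1] by auto
  \<comment> \<open>The fixed-point equation at \<open>y\<close> makes
    \<open>\<phi> (lam * y)\<close> a zero; once it is known to be positive, uniqueness identifies
    it with \<open>y\<close>.\<close>
  have "\<phi> (\<phi> (lam * y)) = 0"
    using fix_eq[of y] y assms unfolding pd_renorm_def scale by simp
  moreover have "0 < \<phi> (lam * y)"
  proof (rule ccontr)
    assume "\<not> ?thesis"
    moreover have "continuous_on {0..lam * y} \<phi>"
      using u(1) by (rule continuous_on_subset) (use ly assms in auto)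
    ultimately obtain v where v: "0 \<le> v" "v \<le> lam * y" "\<phi> v = 0"
      \<comment> \<open>A zero in \<open>[0, lam * y]\<close> would lie in the central interval and
        be mapped to 0 in that same interval, contradicting disjointness.\<close>
      using IVT2'[of \<phi> "lam * y" 0 0] u ly by auto
    then have "0 \<in> \<phi> ` {-lam..lam} \<inter> {-lam..lam}"
      using order.trans[OF v(2) less_imp_le[OF ly(2)]] v(1,3) assms(3)
      by (intro IntI image_eqI[of _ _ v]) auto
    then show False using ren unfolding pd_renormalizable_def Let_def scale by blast
  qed
  moreover have "lam * y \<in> {-1..1}" using ly assms by auto
  then have "\<phi> (lam * y) \<le> 1" using u(2) by (meson atLeastAtMost_iff image_subset_iff)
  ultimately have "\<phi> (lam * y) = y" using uniq by blast
  with y' y uniq that show ?thesis by blast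
qed

theorem lemma2:
  fixes l :: nat and lam x0 :: real
    and f fhat :: "complex \<Rightarrow> complex" and D What :: "complex set"
  assumes "l \<ge> 2" and "even l"
    and "feigenbaum_map l lam f D"
    and "maximal_analytic_extension f D fhat What"
    and "simply_connected What"
    and "first_positive_zero f D x0"
  shows "What = basin_of_attraction (\<lambda>z. fhat (of_real lam * z))
                  ((\<lambda>z. z / of_real lam) ` What) (of_real x0)"
proof -
  from assms(3) obtain \<phi> F G where
    D: "open D" "connected D" "complex_of_real ` {-1..1} \<subseteq> D" "f holomorphic_on D"
    and fp: "pd_fixed_point l \<phi>" and f_phi: "\<And>x. x \<in> {-1..1} \<Longrightarrow> f (of_real x) = of_real (\<phi> x)"
    and lam: "complex_of_real lam = - f (f 0)" "0 < lam" "lam < 1"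
    and ev: "\<forall>\<^sub>F z in nhds 0. f z = - (1 / of_real lam) * f (f (of_real lam * z))"
    and f0: "f 0 = 1"
    and G: "G holomorphic_on slit_plane lam" "inj_on G (slit_plane lam)"
      "\<And>w. w \<in> slit_plane lam \<Longrightarrow> F (G w) = w"
      "\<forall>\<^sub>F z in nhds 0. z ^ l \<in> G ` slit_plane lam \<and> f z = F (z ^ l)"
    unfolding feigenbaum_map_def by blast
  have u: "continuous_on {-1..1} \<phi>" "\<phi> ` {-1..1} \<subseteq> {-1..1}" "\<phi> 0 = 1"
      "strict_antimono_on {0..1} \<phi>"
    using fp by (auto simp: pd_fixed_point_def unimodal_def)
  have "complex_of_real (\<phi> 1) = of_real (- lam)"
    using lam(1) f0 f_phi[of 1] by simp
  then have phi_1: "\<phi> 1 = - lam" by (simp only: of_real_eq_iff)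
  obtain y where y: "0 < y" "y < 1" "\<phi> y = 0" "\<phi> (lam * y) = y"
    and y_unique: "\<And>x. 0 < x \<Longrightarrow> x \<le> 1 \<Longrightarrow> \<phi> x = 0 \<Longrightarrow> x = y"
    using feigenbaum_map_phi[OF fp phi_1 lam(2,3)] by blast
  have yD: "complex_of_real y \<in> D" "f (of_real y) = 0"
    using D(3) y f_phi[of y] by auto
  \<comment> \<open>As \<open>y\<close> is a zero in \<open>D\<close>, minimality forces
    \<open>x0 \<le> y\<close>; this places \<open>x0\<close> where \<open>f\<close> is given by
    \<open>\<phi>\<close>.\<close>
  have x0: "0 < x0" "f (of_real x0) = 0" "\<not> y < x0"
    using assms(6) y(1) yD unfolding first_positive_zero_def by auto
  then have "\<phi> x0 = 0" using f_phi[of x0] y(2) by simp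
  then have [simp]: "x0 = y" using x0 y(2) by (intro y_unique) auto
  have W: "open What" "connected What" "fhat holomorphic_on What"
    using assms(4) by (auto simp: maximal_analytic_extension_def analytic_extension_def)
  have 0: "0 \<in> D" using D(3) by (rule subsetD) (rule image_eqI[of _ _ 0], auto)
  \<comment> \<open>Regarded as an extension of itself, \<open>f\<close> must be a restriction of
    \<open>fhat\<close>.\<close>
  then have "analytic_extension f D f D"
    using D by (auto simp: analytic_extension_def)
  then have DW: "D \<subseteq> What" "\<And>z. z \<in> D \<Longrightarrow> f z = fhat z"
    using assms(4) unfolding maximal_analytic_extension_def by blast+
  have near: "\<forall>\<^sub>F z in nhds 0. f z = fhat z"
    using eventually_nhds_in_open[OF D(1) 0] by eventually_elim (rule DW)
  have fhat_phi: "fhat (of_real x) = of_real (\<phi> x)" if "-1 \<le> x" "x \<le> 1" for x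
  proof -
    have "complex_of_real x \<in> D" using that by (intro subsetD[OF D(3)] imageI) auto
    then show ?thesis using that f_phi[of x] DW(2)[of "of_real x"] by simp
  qed
  interpret feigenbaum_extension l lam x0 \<phi> F G fhat What
  proof
    show "\<forall>\<^sub>F z in nhds 0. fhat z = - (1 / of_real lam) * fhat (fhat (of_real lam * z))"
    proof -
      have "isCont f 0"
        using D(4,1) 0 by (rule holomorphic_on_imp_isCont)
      have l0: "((\<lambda>z. of_real lam * z) \<longlongrightarrow> complex_of_real lam * 0) (nhds 0)"
        by (intro tendsto_intros filterlim_ident)
      then have 1: "\<forall>\<^sub>F z in nhds 0. of_real lam * z \<in> D"
        using D(1) 0 by (intro topological_tendstoD) auto
      have "((\<lambda>z. f (of_real lam * z)) \<longlongrightarrow> f 0) (nhds 0)"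
        using \<open>isCont f 0\<close> l0 by (intro isCont_tendsto_compose[where g = f]) auto
      \<comment> \<open>Transferring the equation to \<open>fhat\<close> requires both
        \<open>lam * z\<close> and \<open>f (lam * z)\<close> to lie in \<open>D\<close>; the latter
        is near \<open>f 0 = 1\<close>.\<close>
      moreover have "f 0 \<in> D" using D(3) f0 by (intro subsetD[OF D(3)] image_eqI[of _ _ 1]) auto
      ultimately have 2: "\<forall>\<^sub>F z in nhds 0. f (of_real lam * z) \<in> D"
        using D(1) by (intro topological_tendstoD) auto
      show ?thesis using ev near 1 2
        by eventually_elim (use DW(2) in \<open>auto simp del: of_real_mult\<close>)
    qed
    show "\<forall>\<^sub>F z in nhds 0. z ^ l \<in> G ` slit_plane lam \<and> fhat z = F (z ^ l)"
      using G(4) near by eventually_elim auto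
    show "- 1 \<le> \<phi> x \<and> \<phi> x \<le> 1" if "-1 \<le> x" "x \<le> 1" for x
      using u(2) that by (meson atLeastAtMost_iff image_subset_iff)
    show "complex_of_real ` {-1..1} \<subseteq> What" using D(3) DW(1) by blast
    fix h U assume h: "open U" "connected U" "0 \<in> U" "h holomorphic_on U" "\<forall>\<^sub>F z in nhds 0. h z = fhat z"
    have "\<forall>\<^sub>F z in nhds 0. h z = f z \<and> z \<in> D \<and> z \<in> U"
      using h(5) near eventually_nhds_in_open[OF D(1) 0] eventually_nhds_in_open[OF h(1,3)]
      by eventually_elim auto
    then obtain S where "open S" "0 \<in> S" "\<And>z. z \<in> S \<Longrightarrow> h z = f z \<and> z \<in> D \<and> z \<in> U"
      unfolding eventually_nhds by blast
    then have "analytic_extension f D h U"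
      using h unfolding analytic_extension_def by blast
    then show "U \<subseteq> What \<and> (\<forall>z\<in>U. h z = fhat z)"
      using assms(4) unfolding maximal_analytic_extension_def by blast
  qed (use assms(1,2) lam(2,3) u(1,3,4) phi_1 y W G(1-3) fhat_phi in simp_all)
  show ?thesis by (rule What_eq_basin)
qed

end
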